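(* Kac--Paljutkin's finite quantum group $\mathcal{A}$ (the $8$-dimensional Hopf $*$-algebra $\mathcal{A}=\mathbb{C}\oplus\mathbb{C}\oplus\mathbb{C}\oplus\mathbb{C}\oplus\mathbb{M}_2$ described in the context) is solvable as a semisimple Hopf algebra.
   Context: All vector spaces and algebras are over $\mathbb{C}$; $\mathbb{M}_2$ is the algebra of complex $2\times 2$ matrices. **Kac--Paljutkin's finite quantum group.** As a $*$-algebra $\mathcal{A}=\mathbb{C}\oplus\mathbb{C}\oplus\mathbb{C}\oplus\mathbb{C}\oplus\mathbb{M}_2$. Let $e_1,e_2,e_3,e_4$ be the units of the four one-dimensional summands and $a_{ij}$ ($i,j=1,2$) the matrix units of $\mathbb{M}_2$; these $8$ elements form a basis. The comultiplication $\Delta$, counit $\epsilon$ and antipode $S$ are given by $$\Delta(e_1)=e_1\otimes e_1+e_2\otimes e_2+e_3\otimes e_3+e_4\otimes e_4+\tfrac12(a_{11}\otimes a_{11}+a_{12}\otimes a_{12}+a_{21}\otimes a_{21}+a_{22}\otimes a_{22}),$$ $$\Delta(e_2)=e_1\otimes e_2+e_2\otimes e_1+e_3\otimes e_4+e_4\otimes e_3+\tfrac12 a_{11}\otimes a_{22}+\tfrac12 a_{22}\otimes a_{11}-\tfrac{\sqrt{-1}}2a_{12}\otimes a_{21}+\tfrac{\sqrt{-1}}2a_{21}\otimes a_{12},$$ $$\Delta(e_3)=e_1\otimes e_3+e_3\otimes e_1+e_2\otimes e_4+e_4\otimes e_2+\tfrac12 a_{11}\otimes a_{22}+\tfrac12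 a_{22}\otimes a_{11}+\tfrac{\sqrt{-1}}2a_{12}\otimes a_{21}-\tfrac{\sqrt{-1}}2a_{21}\otimes a_{12},$$ $$\Delta(e_4)=e_1\otimes e_4+e_4\otimes e_1+e_2\otimes e_3+e_3\otimes e_2+\tfrac12 a_{11}\otimes a_{11}+\tfrac12 a_{22}\otimes a_{22}-\tfrac12a_{12}\otimes a_{12}-\tfrac12a_{21}\otimes a_{21},$$ $$\Delta(a_{11})=e_1\otimes a_{11}+a_{11}\otimes e_1+e_2\otimes a_{22}+a_{22}\otimes e_2+e_3\otimes a_{22}+a_{22}\otimes e_3+e_4\otimes a_{11}+a_{11}\otimes e_4,$$ $$\Delta(a_{12})=e_1\otimes a_{12}+a_{12}\otimes e_1+\sqrt{-1}\,e_2\otimes a_{21}-\sqrt{-1}\,a_{21}\otimes e_2-\sqrt{-1}\,e_3\otimes a_{21}+\sqrt{-1}\,a_{21}\otimes e_3-e_4\otimes a_{12}-a_{12}\otimes e_4,$$ $$\Delta(a_{21})=e_1\otimes a_{21}+a_{21}\otimes e_1-\sqrt{-1}\,e_2\otimes a_{12}+\sqrt{-1}\,a_{12}\otimes e_2+\sqrt{-1}\,e_3\otimes a_{12}-\sqrt{-1}\,a_{12}\otimes e_3-e_4\otimes a_{21}-a_{21}\otimes e_4,$$ $$\Delta(a_{22})=e_1\otimes a_{22}+a_{22}\otimes e_1+e_2\otimes a_{11}+a_{11}\otimes e_2+e_3\otimes a_{11}+a_{11}\otimes e_3+e_4\otimes a_{22}+a_{22}\otimes e_4,$$ $\epsilon(e_1)=1$,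 $\epsilon(e_2)=\epsilon(e_3)=\epsilon(e_4)=0$, $\epsilon(a_{ij})=0$, $S(e_i)=e_i$, $S(a_{ij})=a_{ji}$. **Definitions.** Let $A$ be a semisimple Hopf algebra, with Sweedler notation $\Delta(a)=a_{(1)}\otimes a_{(2)}$. A unital left coideal subalgebra of $A$ is a unital subalgebra $L\subseteq A$ with $\Delta(L)\subseteq A\otimes L$. An integral of $L$ is a nonzero element $l\in L$ with $lx=xl=\epsilon(x)l$ for all $x\in L$ (unique up to a nonzero scalar). For $a,b\in A$ put $a\bullet_{\mathrm{ad}} b=a_{(1)}\,b\,S(a_{(2)})$. $Z(\cdot)$ denotes the center of an algebra. A chain $L_0\subset L_1\subset\cdots\subset L_i$ of unital left coideal subalgebras of $A$ is a solvable series if for all $0\le j\le i-1$, with $l_j$ the integral of $L_j$: (1) $l_j\in Z(L_{j+1})$; (2) $(a\bullet_{\mathrm{ad}} b)\,l_j=\epsilon(a)\,b\,l_j$ for all $a,b\in L_{j+1}$. $A$ is solvable if it has a solvable series with $L_0=\mathbb{C}1$ and $L_i=A$. *)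

theory Defs
  imports "HOL-Analysis.Analysis"
begin

section \<open>Tensor products in coordinates\<close>

text \<open>
  A semisimple Hopf algebra is finite-dimensional, so its underlying vector space is taken to be
  \<open>complex ^ 'n\<close> for an arbitrary finite type \<open>'n\<close> labelling a basis. The tensor product of
  \<open>complex ^ 'n\<close> and \<open>complex ^ 'm\<close> is modelled by \<open>complex ^ ('n \<times> 'm)\<close>, with the basis vector
  labelled \<open>(i, j)\<close> being the tensor product of the basis vectors labelled \<open>i\<close> and \<open>j\<close>.
\<close>

definition tensor :: "complex ^ 'n \<Rightarrow> complex ^ 'm \<Rightarrow> complex ^ ('n \<times> 'm)" (infixr "\<otimes>" 75) where
  "x \<otimes> y = (\<chi> p. x $ fst p * y $ snd p)"

text \<open>
  The linear map on the tensor product induced by a bilinear map \<open>B\<close>. Hence, for a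
  comultiplication \<open>\<Delta>\<close>, the vector \<open>tensor_lift B (\<Delta> a)\<close> is
  what Sweedler notation writes as \<open>B a\<^sub>(\<^sub>1\<^sub>) a\<^sub>(\<^sub>2\<^sub>)\<close>.
\<close>

definition tensor_lift ::
    "(complex ^ 'n \<Rightarrow> complex ^ 'm \<Rightarrow> complex ^ 'k) \<Rightarrow> complex ^ ('n \<times> 'm) \<Rightarrow> complex ^ 'k" where
  "tensor_lift B t = (\<Sum>i\<in>UNIV. \<Sum>j\<in>UNIV. t $ (i, j) *s B (axis i 1) (axis j 1))"

definition tensor_subspace ::
    "(complex ^ 'n) set \<Rightarrow> (complex ^ 'm) set \<Rightarrow> (complex ^ ('n \<times> 'm)) set" where
  "tensor_subspace V W = vec.span {v \<otimes> w | v w. v \<in> V \<and> w \<in> W}"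


section \<open>Hopf algebras\<close>

locale hopf_algebra =
  fixes mult :: "complex ^ 'n \<Rightarrow> complex ^ 'n \<Rightarrow> complex ^ 'n" (infixl "\<odot>" 78)
    and one :: "complex ^ 'n"
    and comult :: "complex ^ 'n \<Rightarrow> complex ^ ('n \<times> 'n)"
    and counit :: "complex ^ 'n \<Rightarrow> complex"
    and antipode :: "complex ^ 'n \<Rightarrow> complex ^ 'n"
  assumes mult_linear_right: "Vector_Spaces.linear (*s) (*s) (\<lambda>y. x \<odot> y)"
    and mult_linear_left: "Vector_Spaces.linear (*s) (*s) (\<lambda>x. x \<odot> y)"
    and mult_assoc: "(x \<odot> y) \<odot> z = x \<odot> (y \<odot> z)"
    and one_mult: "one \<odot> x = x"
    and mult_one: "x \<odot> one = x"
    and comult_linear: "Vector_Spaces.linear (*s) (*s) comult"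
    and counit_linear: "Vector_Spaces.linear (*s) (*) counit"
    and comult_coassoc:
      "tensor_lift (\<lambda>u v. tensor_lift (\<lambda>u\<^sub>1 u\<^sub>2. u\<^sub>1 \<otimes> u\<^sub>2 \<otimes> v) (comult u)) (comult x) =
       tensor_lift (\<lambda>u v. u \<otimes> comult v) (comult x)"
    and counit_left: "tensor_lift (\<lambda>u v. counit u *s v) (comult x) = x"
    and counit_right: "tensor_lift (\<lambda>u v. counit v *s u) (comult x) = x"
    and comult_mult:
      "comult (x \<odot> y) =
       tensor_lift (\<lambda>u v. tensor_lift (\<lambda>u' v'. (u \<odot> u') \<otimes> (v \<odot> v')) (comult y)) (comult x)"
    and comult_one: "comult one = one \<otimes> one"
    and counit_mult: "counit (x \<odot> y) = counit x * counit y"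
    and counit_one: "counit one = 1"
    and antipode_linear: "Vector_Spaces.linear (*s) (*s) antipode"
    and antipode_left: "tensor_lift (\<lambda>u v. antipode u \<odot> v) (comult x) = counit x *s one"
    and antipode_right: "tensor_lift (\<lambda>u v. u \<odot> antipode v) (comult x) = counit x *s one"
begin

definition left_ideal :: "(complex ^ 'n) set \<Rightarrow> bool" where
  "left_ideal I \<longleftrightarrow> vec.subspace I \<and> (\<forall>a. \<forall>x\<in>I. a \<odot> x \<in> I)"

definition unital_subalgebra :: "(complex ^ 'n) set \<Rightarrow> bool" where
  "unital_subalgebra L \<longleftrightarrow>
     vec.subspace L \<and> one \<in> L \<and> (\<forall>x\<in>L. \<forall>y\<in>L. x \<odot> y \<in> L)"

definition left_coideal_subalgebra :: "(complex ^ 'n) set \<Rightarrow> bool" where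
  "left_coideal_subalgebra L \<longleftrightarrow>
     unital_subalgebra L \<and> (\<forall>x\<in>L. comult x \<in> tensor_subspace UNIV L)"

definition integral_of :: "(complex ^ 'n) set \<Rightarrow> complex ^ 'n \<Rightarrow> bool" where
  "integral_of L l \<longleftrightarrow>
     l \<in> L \<and> l \<noteq> 0 \<and> (\<forall>x\<in>L. l \<odot> x = counit x *s l \<and> x \<odot> l = counit x *s l)"

definition center_of :: "(complex ^ 'n) set \<Rightarrow> (complex ^ 'n) set" where
  "center_of L = {z \<in> L. \<forall>x\<in>L. z \<odot> x = x \<odot> z}"

definition adjoint_action :: "complex ^ 'n \<Rightarrow> complex ^ 'n \<Rightarrow> complex ^ 'n"
    (infixr "\<bullet>\<^sub>a\<^sub>d" 79) where
  "a \<bullet>\<^sub>a\<^sub>d b = tensor_lift (\<lambda>u v. u \<odot> b \<odot> antipode v) (comult a)"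

end

text \<open>
  Semisimplicity of the underlying algebra: the left regular module is semisimple, i.e.\ every
  submodule (left ideal) is a direct summand.
\<close>

locale semisimple_hopf_algebra = hopf_algebra +
  assumes semisimple:
    "left_ideal I \<Longrightarrow>
       \<exists>J. left_ideal J \<and> I \<inter> J = {0} \<and> {x + y | x y. x \<in> I \<and> y \<in> J} = UNIV"
begin

text \<open>
  The integral of \<open>L j\<close> is unique up to a nonzero scalar, and the two conditions on it are
  invariant under scaling, so the choice of \<open>l\<close> is immaterial.
\<close>

definition solvable_series :: "nat \<Rightarrow> (nat \<Rightarrow> (complex ^ 'a) set) \<Rightarrow> bool" where
  "solvable_series i L \<longleftrightarrow>
     (\<forall>j\<le>i. left_coideal_subalgebra (L j)) \<and>
     (\<forall>j<i. L j \<subset> L (Suc j)) \<and>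
     (\<forall>j<i. \<exists>l. integral_of (L j) l \<and>
        l \<in> center_of (L (Suc j)) \<and>
        (\<forall>a\<in>L (Suc j). \<forall>b\<in>L (Suc j). (a \<bullet>\<^sub>a\<^sub>d b) \<odot> l = counit a *s (b \<odot> l)))"

definition solvable :: bool where
  "solvable \<longleftrightarrow> (\<exists>i L. solvable_series i L \<and> L 0 = vec.span {one} \<and> L i = UNIV)"

end


section \<open>The Kac--Paljutkin algebra\<close>

text \<open>
  \<open>E1\<close>, \<dots>, \<open>E4\<close> label the units of the four one-dimensional summands, and \<open>A11\<close>, \<dots>, \<open>A22\<close> the
  matrix units of the summand of \<open>2 \<times> 2\<close> matrices.
\<close>

datatype kp_index = E1 | E2 | E3 | E4 | A11 | A12 | A21 | A22

instance kp_index :: finite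
proof
  have "(UNIV :: kp_index set) = {E1, E2, E3, E4, A11, A12, A21, A22}"
    using kp_index.exhaust by blast
  then show "finite (UNIV :: kp_index set)"
    by (metis finite.simps)
qed

abbreviation kp_basis :: "kp_index \<Rightarrow> complex ^ kp_index" ("\<beta>") where
  "\<beta> k \<equiv> axis k 1"

abbreviation kp_basis_tensor :: "kp_index \<Rightarrow> kp_index \<Rightarrow> complex ^ (kp_index \<times> kp_index)"
    (infix "\<boxtimes>" 75) where
  "i \<boxtimes> j \<equiv> \<beta> i \<otimes> \<beta> j"

definition kp_mult :: "complex ^ kp_index \<Rightarrow> complex ^ kp_index \<Rightarrow> complex ^ kp_index" where
  "kp_mult x y = (\<chi> k. case k of
       E1 \<Rightarrow> x $ E1 * y $ E1
     | E2 \<Rightarrow> x $ E2 * y $ E2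
     | E3 \<Rightarrow> x $ E3 * y $ E3
     | E4 \<Rightarrow> x $ E4 * y $ E4
     | A11 \<Rightarrow> x $ A11 * y $ A11 + x $ A12 * y $ A21
     | A12 \<Rightarrow> x $ A11 * y $ A12 + x $ A12 * y $ A22
     | A21 \<Rightarrow> x $ A21 * y $ A11 + x $ A22 * y $ A21
     | A22 \<Rightarrow> x $ A21 * y $ A12 + x $ A22 * y $ A22)"

definition kp_one :: "complex ^ kp_index" where
  "kp_one = \<beta> E1 + \<beta> E2 + \<beta> E3 + \<beta> E4 + \<beta> A11 + \<beta> A22"

fun kp_comult_basis :: "kp_index \<Rightarrow> complex ^ (kp_index \<times> kp_index)" where
  "kp_comult_basis E1 =
     E1 \<boxtimes> E1 + E2 \<boxtimes> E2 + E3 \<boxtimes> E3 + E4 \<boxtimes> E4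
     + (1/2) *s (A11 \<boxtimes> A11 + A12 \<boxtimes> A12 + A21 \<boxtimes> A21 + A22 \<boxtimes> A22)"
| "kp_comult_basis E2 =
     E1 \<boxtimes> E2 + E2 \<boxtimes> E1 + E3 \<boxtimes> E4 + E4 \<boxtimes> E3
     + (1/2) *s (A11 \<boxtimes> A22) + (1/2) *s (A22 \<boxtimes> A11)
     - (\<i>/2) *s (A12 \<boxtimes> A21) + (\<i>/2) *s (A21 \<boxtimes> A12)"
| "kp_comult_basis E3 =
     E1 \<boxtimes> E3 + E3 \<boxtimes> E1 + E2 \<boxtimes> E4 + E4 \<boxtimes> E2
     + (1/2) *s (A11 \<boxtimes> A22) + (1/2) *s (A22 \<boxtimes> A11)
     + (\<i>/2) *s (A12 \<boxtimes> A21) - (\<i>/2) *s (A21 \<boxtimes> A12)"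
| "kp_comult_basis E4 =
     E1 \<boxtimes> E4 + E4 \<boxtimes> E1 + E2 \<boxtimes> E3 + E3 \<boxtimes> E2
     + (1/2) *s (A11 \<boxtimes> A11) + (1/2) *s (A22 \<boxtimes> A22)
     - (1/2) *s (A12 \<boxtimes> A12) - (1/2) *s (A21 \<boxtimes> A21)"
| "kp_comult_basis A11 =
     E1 \<boxtimes> A11 + A11 \<boxtimes> E1 + E2 \<boxtimes> A22 + A22 \<boxtimes> E2
     + E3 \<boxtimes> A22 + A22 \<boxtimes> E3 + E4 \<boxtimes> A11 + A11 \<boxtimes> E4"
| "kp_comult_basis A12 =
     E1 \<boxtimes> A12 + A12 \<boxtimes> E1 + \<i> *s (E2 \<boxtimes> A21) - \<i> *s (A21 \<boxtimes> E2)
     - \<i> *s (E3 \<boxtimes> A21) + \<i> *s (A21 \<boxtimes> E3) - E4 \<boxtimes> A12 - A12 \<boxtimes> E4"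
| "kp_comult_basis A21 =
     E1 \<boxtimes> A21 + A21 \<boxtimes> E1 - \<i> *s (E2 \<boxtimes> A12) + \<i> *s (A12 \<boxtimes> E2)
     + \<i> *s (E3 \<boxtimes> A12) - \<i> *s (A12 \<boxtimes> E3) - E4 \<boxtimes> A21 - A21 \<boxtimes> E4"
| "kp_comult_basis A22 =
     E1 \<boxtimes> A22 + A22 \<boxtimes> E1 + E2 \<boxtimes> A11 + A11 \<boxtimes> E2
     + E3 \<boxtimes> A11 + A11 \<boxtimes> E3 + E4 \<boxtimes> A22 + A22 \<boxtimes> E4"

definition kp_comult :: "complex ^ kp_index \<Rightarrow> complex ^ (kp_index \<times> kp_index)" where
  "kp_comult x = (\<Sum>k\<in>UNIV. x $ k *s kp_comult_basis k)"

definition kp_counit :: "complex ^ kp_index \<Rightarrow> complex" where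
  "kp_counit x = x $ E1"

fun kp_antipode_index :: "kp_index \<Rightarrow> kp_index" where
  "kp_antipode_index A12 = A21"
| "kp_antipode_index A21 = A12"
| "kp_antipode_index k = k"

definition kp_antipode :: "complex ^ kp_index \<Rightarrow> complex ^ kp_index" where
  "kp_antipode x = (\<Sum>k\<in>UNIV. x $ k *s \<beta> (kp_antipode_index k))"

end

theory Submission
  imports Defs
begin

text \<open>
  Let \<open>l = e\<^sub>1 + e\<^sub>2 + e\<^sub>3 + e\<^sub>4\<close>. Then \<open>z = l - (1 - l)\<close> is a central group-like element of order two,
  and \<open>\<complex>1 \<subset> \<complex>1 + \<complex>z \<subset> \<A>\<close> is a solvable series with integrals \<open>1\<close> and \<open>l\<close>. Over the central
  group algebra \<open>\<complex>1 + \<complex>z\<close> the adjoint action is trivial by centrality, and multiplying by \<open>l\<close>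
  projects \<open>\<A>\<close> onto its four one-dimensional summands, a commutative quotient Hopf algebra on which
  the adjoint action is trivial as well.
\<close>

section \<open>Coordinates\<close>

lemma UNIV_kp_index: "(UNIV :: kp_index set) = {E1, E2, E3, E4, A11, A12, A21, A22}"
  using kp_index.exhaust by blast

lemma sum_kp_index:
  "(\<Sum>k\<in>UNIV. f k) = f E1 + f E2 + f E3 + f E4 + f A11 + f A12 + f A21 + (f A22 :: 'a::comm_monoid_add)"
  unfolding UNIV_kp_index by (simp add: add.assoc)

lemma all_kp_index:
  "(\<forall>k. P k) \<longleftrightarrow> P E1 \<and> P E2 \<and> P E3 \<and> P E4 \<and> P A11 \<and> P A12 \<and> P A21 \<and> P A22"
  by (metis kp_index.exhaust)

lemma tensor_nth [simp]: "(x \<otimes> y) $ (i, j) = x $ i * y $ j"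
  by (simp add: tensor_def)

lemma tensor_lift_nth:
  "tensor_lift B t $ k = (\<Sum>i\<in>UNIV. \<Sum>j\<in>UNIV. t $ (i, j) * B (axis i 1) (axis j 1) $ k)"
  by (simp add: tensor_lift_def)

lemma axis_one_nth: "axis i (1 :: 'a::zero_neq_one) $ j = (if j = i then 1 else 0)"
  by (simp add: axis_def)

lemma kp_mult_nth [simp]:
  "kp_mult x y $ E1 = x $ E1 * y $ E1"
  "kp_mult x y $ E2 = x $ E2 * y $ E2"
  "kp_mult x y $ E3 = x $ E3 * y $ E3"
  "kp_mult x y $ E4 = x $ E4 * y $ E4"
  "kp_mult x y $ A11 = x $ A11 * y $ A11 + x $ A12 * y $ A21"
  "kp_mult x y $ A12 = x $ A11 * y $ A12 + x $ A12 * y $ A22"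
  "kp_mult x y $ A21 = x $ A21 * y $ A11 + x $ A22 * y $ A21"
  "kp_mult x y $ A22 = x $ A21 * y $ A12 + x $ A22 * y $ A22"
  by (simp_all add: kp_mult_def)

lemma kp_one_nth [simp]:
  "kp_one $ E1 = 1" "kp_one $ E2 = 1" "kp_one $ E3 = 1" "kp_one $ E4 = 1"
  "kp_one $ A11 = 1" "kp_one $ A12 = 0" "kp_one $ A21 = 0" "kp_one $ A22 = 1"
  by (simp_all add: kp_one_def axis_def)

lemma kp_antipode_axis: "kp_antipode (axis k 1) = axis (kp_antipode_index k) 1"
  by (cases k) (simp_all add: kp_antipode_def sum_kp_index axis_one_nth)

text \<open>The transpose of the table \<open>kp_comult_basis\<close>: sorted by tensor label
  instead of by basis element, each coordinate of a coproduct involves at most two coordinates of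
  \<open>x\<close>.\<close>

fun kp_coeff :: "complex ^ kp_index \<Rightarrow> kp_index \<Rightarrow> kp_index \<Rightarrow> complex" where
  "kp_coeff x E1 E1 = x $ E1"
| "kp_coeff x E1 E2 = x $ E2"
| "kp_coeff x E1 E3 = x $ E3"
| "kp_coeff x E1 E4 = x $ E4"
| "kp_coeff x E1 A11 = x $ A11"
| "kp_coeff x E1 A12 = x $ A12"
| "kp_coeff x E1 A21 = x $ A21"
| "kp_coeff x E1 A22 = x $ A22"
| "kp_coeff x E2 E1 = x $ E2"
| "kp_coeff x E2 E2 = x $ E1"
| "kp_coeff x E2 E3 = x $ E4"
| "kp_coeff x E2 E4 = x $ E3"
| "kp_coeff x E2 A11 = x $ A22"
| "kp_coeff x E2 A12 = - \<i> * x $ A21"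
| "kp_coeff x E2 A21 = \<i> * x $ A12"
| "kp_coeff x E2 A22 = x $ A11"
| "kp_coeff x E3 E1 = x $ E3"
| "kp_coeff x E3 E2 = x $ E4"
| "kp_coeff x E3 E3 = x $ E1"
| "kp_coeff x E3 E4 = x $ E2"
| "kp_coeff x E3 A11 = x $ A22"
| "kp_coeff x E3 A12 = \<i> * x $ A21"
| "kp_coeff x E3 A21 = - \<i> * x $ A12"
| "kp_coeff x E3 A22 = x $ A11"
| "kp_coeff x E4 E1 = x $ E4"
| "kp_coeff x E4 E2 = x $ E3"
| "kp_coeff x E4 E3 = x $ E2"
| "kp_coeff x E4 E4 = x $ E1"
| "kp_coeff x E4 A11 = x $ A11"
| "kp_coeff x E4 A12 = - x $ A12"
| "kp_coeff x E4 A21 = - x $ A21"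
| "kp_coeff x E4 A22 = x $ A22"
| "kp_coeff x A11 E1 = x $ A11"
| "kp_coeff x A11 E2 = x $ A22"
| "kp_coeff x A11 E3 = x $ A22"
| "kp_coeff x A11 E4 = x $ A11"
| "kp_coeff x A11 A11 = 1/2 * x $ E1 + 1/2 * x $ E4"
| "kp_coeff x A11 A12 = 0"
| "kp_coeff x A11 A21 = 0"
| "kp_coeff x A11 A22 = 1/2 * x $ E2 + 1/2 * x $ E3"
| "kp_coeff x A12 E1 = x $ A12"
| "kp_coeff x A12 E2 = \<i> * x $ A21"
| "kp_coeff x A12 E3 = - \<i> * x $ A21"
| "kp_coeff x A12 E4 = - x $ A12"
| "kp_coeff x A12 A11 = 0"
| "kp_coeff x A12 A12 = 1/2 * x $ E1 - 1/2 * x $ E4"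
| "kp_coeff x A12 A21 = - \<i>/2 * x $ E2 + \<i>/2 * x $ E3"
| "kp_coeff x A12 A22 = 0"
| "kp_coeff x A21 E1 = x $ A21"
| "kp_coeff x A21 E2 = - \<i> * x $ A12"
| "kp_coeff x A21 E3 = \<i> * x $ A12"
| "kp_coeff x A21 E4 = - x $ A21"
| "kp_coeff x A21 A11 = 0"
| "kp_coeff x A21 A12 = \<i>/2 * x $ E2 - \<i>/2 * x $ E3"
| "kp_coeff x A21 A21 = 1/2 * x $ E1 - 1/2 * x $ E4"
| "kp_coeff x A21 A22 = 0"
| "kp_coeff x A22 E1 = x $ A22"
| "kp_coeff x A22 E2 = x $ A11"
| "kp_coeff x A22 E3 = x $ A11"
| "kp_coeff x A22 E4 = x $ A22"
| "kp_coeff x A22 A11 = 1/2 * x $ E2 + 1/2 * x $ E3"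
| "kp_coeff x A22 A12 = 0"
| "kp_coeff x A22 A21 = 0"
| "kp_coeff x A22 A22 = 1/2 * x $ E1 + 1/2 * x $ E4"

lemma kp_comult_nth [simp]: "kp_comult x $ (i, j) = kp_coeff x i j"
  by (cases i; cases j) (simp_all add: kp_comult_def sum_kp_index axis_def field_simps)

section \<open>The Hopf algebra axioms\<close>

text \<open>The legs that \<open>D\<close> leaves alone are basis vectors, so their sums are
  Kronecker deltas and collapse; only the label fed to \<open>D\<close> is still summed
  over.\<close>

lemma tensor_lift_coassoc_nth:
  "tensor_lift (\<lambda>u v. tensor_lift (\<lambda>u1 u2. u1 \<otimes> u2 \<otimes> v) (D u)) t $ (a, b, c) =
     (\<Sum>i\<in>UNIV. t $ (i, c) * D (axis i 1) $ (a, b))"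
  "tensor_lift (\<lambda>u v. u \<otimes> D v) t $ (a, b, c) =
     (\<Sum>i\<in>UNIV. t $ (a, i) * D (axis i 1) $ (b, c))"
proof -
  have *: "(\<Sum>i\<in>UNIV. \<Sum>j\<in>UNIV. F i j * (axis i 1 $ a * (axis j 1 $ b * d))) = F a b * d"
    for F :: "'x::finite \<Rightarrow> 'y::finite \<Rightarrow> complex" and a b d
    by (simp add: axis_def if_distrib [of "(*) _"] if_distrib [of "\<lambda>x. x * _"] sum.delta cong: if_cong)
  have **: "(\<Sum>j\<in>UNIV. F j * (d j * axis j 1 $ c)) = F c * d c"
    for F d :: "'x::finite \<Rightarrow> complex" and c
    by (simp add: axis_def if_distrib [of "(*) _"] sum.delta cong: if_cong)
  show "tensor_lift (\<lambda>u v. tensor_lift (\<lambda>u1 u2. u1 \<otimes> u2 \<otimes> v) (D u)) t $ (a, b, c) =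
     (\<Sum>i\<in>UNIV. t $ (i, c) * D (axis i 1) $ (a, b))"
    by (simp add: tensor_lift_nth * **)
  have ***: "(\<Sum>i\<in>UNIV. \<Sum>j\<in>UNIV. F i j * (axis i 1 $ a * d j)) = (\<Sum>j\<in>UNIV. F a j * d j)"
    for F :: "'x::finite \<Rightarrow> 'y::finite \<Rightarrow> complex" and a d
    \<comment> \<open>The delta is in the outer index \<open>i\<close>; swapping brings it
      innermost, where \<open>sum.delta\<close> applies.\<close>
    by (subst sum.swap)
      (simp add: axis_def if_distrib [of "(*) _"] if_distrib [of "\<lambda>x. x * _"] sum.delta cong: if_cong)
  show "tensor_lift (\<lambda>u v. u \<otimes> D v) t $ (a, b, c) =
     (\<Sum>i\<in>UNIV. t $ (a, i) * D (axis i 1) $ (b, c))"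
    by (simp add: tensor_lift_nth ***)
qed

lemma kp_coassoc:
  "tensor_lift (\<lambda>u v. tensor_lift (\<lambda>u1 u2. u1 \<otimes> u2 \<otimes> v) (kp_comult u)) (kp_comult x) =
   tensor_lift (\<lambda>u v. u \<otimes> kp_comult v) (kp_comult x)"
proof -
  have "(\<Sum>i\<in>UNIV. kp_coeff x i c * kp_coeff (axis i 1) a b) =
        (\<Sum>i\<in>UNIV. kp_coeff x a i * kp_coeff (axis i 1) b c)" for a b c
    unfolding sum_kp_index
    by (cases a; cases b; cases c) (simp_all add: axis_one_nth algebra_simps)
  then show ?thesis
    by (simp add: vec_eq_iff tensor_lift_coassoc_nth)
qed

text \<open>
  \<open>kp_form k\<close> is the bilinear form giving the \<open>k\<close>-coordinate of a product. Comparing coordinates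
  through it leaves identities of at most four terms, instead of sums over all quadruples of labels.
\<close>

fun kp_form :: "kp_index \<Rightarrow> (kp_index \<Rightarrow> kp_index \<Rightarrow> complex) \<Rightarrow> complex" where
  "kp_form A11 F = F A11 A11 + F A12 A21"
| "kp_form A12 F = F A11 A12 + F A12 A22"
| "kp_form A21 F = F A21 A11 + F A22 A21"
| "kp_form A22 F = F A21 A12 + F A22 A22"
| "kp_form k F = F k k"

lemma sum_kp_mult:
  "(\<Sum>u\<in>UNIV. \<Sum>v\<in>UNIV. F u v * kp_mult (axis u 1) (axis v 1) $ k) = kp_form k F"
  unfolding sum_kp_index by (cases k) (simp_all add: axis_def)

text \<open>The product of the tensor square is taken leg by leg: once the sums are regrouped so
  that \<open>u\<close> meets \<open>u'\<close> and \<open>v\<close> meets \<open>v'\<close>, each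
  leg is an instance of \<open>sum_kp_mult\<close>.\<close>

lemma kp_tensor_mult_nth:
  "tensor_lift (\<lambda>u v. tensor_lift (\<lambda>u' v'. kp_mult u u' \<otimes> kp_mult v v') s) t $ (p, q) =
     kp_form p (\<lambda>u u'. kp_form q (\<lambda>v v'. t $ (u, v) * s $ (u', v')))" (is "?l = _")
proof -
  let ?m = "\<lambda>k u u'. kp_mult (axis u 1) (axis u' 1) $ k"
  have "?l = (\<Sum>u\<in>UNIV. \<Sum>v\<in>UNIV. \<Sum>u'\<in>UNIV. \<Sum>v'\<in>UNIV.
      t $ (u, v) * s $ (u', v') * ?m q v v' * ?m p u u')"
    by (simp add: tensor_lift_nth sum_distrib_left mult_ac)
  also have "\<dots> = (\<Sum>u\<in>UNIV. \<Sum>u'\<in>UNIV. \<Sum>v\<in>UNIV. \<Sum>v'\<in>UNIV.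
      t $ (u, v) * s $ (u', v') * ?m q v v' * ?m p u u')"
    by (intro sum.cong refl sum.swap)
  also have "\<dots> = (\<Sum>u\<in>UNIV. \<Sum>u'\<in>UNIV.
      (\<Sum>v\<in>UNIV. \<Sum>v'\<in>UNIV. t $ (u, v) * s $ (u', v') * ?m q v v') * ?m p u u')"
    by (simp only: sum_distrib_right)
  finally show ?thesis
    by (simp only: sum_kp_mult)
qed

lemma kp_comult_mult:
  "kp_comult (kp_mult x y) =
     tensor_lift (\<lambda>u v. tensor_lift (\<lambda>u' v'. kp_mult u u' \<otimes> kp_mult v v') (kp_comult y))
       (kp_comult x)"
proof -
  have "kp_coeff (kp_mult x y) p q =
      kp_form p (\<lambda>u u'. kp_form q (\<lambda>v v'. kp_coeff x u v * kp_coeff y u' v'))" for p q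
    by (cases p; cases q) (simp_all add: field_simps)
  then show ?thesis
    by (simp add: vec_eq_iff kp_tensor_mult_nth)
qed

lemma kp_antipode:
  "tensor_lift (\<lambda>u v. kp_mult (kp_antipode u) v) (kp_comult x) = kp_counit x *s kp_one"
  "tensor_lift (\<lambda>u v. kp_mult u (kp_antipode v)) (kp_comult x) = kp_counit x *s kp_one"
  by (simp_all add: vec_eq_iff all_kp_index tensor_lift_nth kp_antipode_axis sum_kp_index
      axis_one_nth kp_counit_def)

lemma kp_coeff_linear:
  "kp_coeff (x + y) i j = kp_coeff x i j + kp_coeff y i j"
  "kp_coeff (c *s x) i j = c * kp_coeff x i j"
  by (cases i; cases j; simp add: field_simps)+

lemma kp_mult_linear:
  "kp_mult x (y + z) = kp_mult x y + kp_mult x z"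
  "kp_mult x (c *s y) = c *s kp_mult x y"
  by (simp_all add: vec_eq_iff all_kp_index algebra_simps)

lemma kp_hopf_algebra: "hopf_algebra kp_mult kp_one kp_comult kp_counit kp_antipode"
proof (rule hopf_algebra.intro)
  show "Vector_Spaces.linear (*s) (*s) (\<lambda>y. kp_mult x y)" for x
    by (unfold_locales) (simp_all add: vec_eq_iff all_kp_index algebra_simps)
  show "Vector_Spaces.linear (*s) (*s) (\<lambda>x. kp_mult x y)" for y
    by (unfold_locales) (simp_all add: vec_eq_iff all_kp_index algebra_simps)
  show "Vector_Spaces.linear (*s) (*s) kp_comult"
    by (unfold_locales) (simp_all add: vec_eq_iff kp_coeff_linear)
  show "Vector_Spaces.linear (*s) (*) kp_counit"
    by (unfold_locales) (simp_all add: kp_counit_def algebra_simps)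
  show "Vector_Spaces.linear (*s) (*s) kp_antipode"
    by (unfold_locales)
      (simp_all add: kp_antipode_def sum.distrib vec.scale_sum_right vector_sadd_rdistrib)
  show "kp_mult (kp_mult x y) z = kp_mult x (kp_mult y z)" for x y z
    by (simp add: vec_eq_iff all_kp_index algebra_simps)
  show "kp_mult kp_one x = x" "kp_mult x kp_one = x" for x
    by (simp_all add: vec_eq_iff all_kp_index)
  show "tensor_lift (\<lambda>u v. kp_counit u *s v) (kp_comult x) = x"
    "tensor_lift (\<lambda>u v. kp_counit v *s u) (kp_comult x) = x" for x
    by (simp_all add: vec_eq_iff all_kp_index tensor_lift_nth kp_counit_def sum_kp_index axis_one_nth)
  have "kp_coeff kp_one i j = kp_one $ i * kp_one $ j" for i j
    by (cases i; cases j) simp_all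
  then show "kp_comult kp_one = kp_one \<otimes> kp_one"
    by (simp add: vec_eq_iff)
qed (simp_all add: kp_coassoc kp_comult_mult kp_antipode kp_counit_def)

section \<open>Semisimplicity\<close>

text \<open>
  Averaging a linear projection \<open>P\<close> onto a left ideal along the separability idempotent
  \<open>e\<^sub>1 \<otimes> e\<^sub>1 + \<dots> + e\<^sub>4 \<otimes> e\<^sub>4 + a\<^sub>1\<^sub>1 \<otimes> a\<^sub>1\<^sub>1 + a\<^sub>2\<^sub>1 \<otimes> a\<^sub>1\<^sub>2\<close> turns it into a module homomorphism,
  whose kernel is a complement.
\<close>

definition kp_average ::
    "(complex ^ kp_index \<Rightarrow> complex ^ kp_index) \<Rightarrow> complex ^ kp_index \<Rightarrow> complex ^ kp_index" where
  "kp_average P x =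
     kp_mult (\<beta> E1) (P (kp_mult (\<beta> E1) x)) + kp_mult (\<beta> E2) (P (kp_mult (\<beta> E2) x))
     + kp_mult (\<beta> E3) (P (kp_mult (\<beta> E3) x)) + kp_mult (\<beta> E4) (P (kp_mult (\<beta> E4) x))
     + kp_mult (\<beta> A11) (P (kp_mult (\<beta> A11) x)) + kp_mult (\<beta> A21) (P (kp_mult (\<beta> A12) x))"

text \<open>Writing the separability idempotent as a sum of x_i \<otimes> y_i, one has a x_i
  \<otimes> y_i = x_i \<otimes> y_i a after summation, so \<open>a\<close> moves from inside
  \<open>P\<close> to the far left.\<close>

lemma kp_average_mult:
  assumes "Vector_Spaces.linear (*s) (*s) P"
  shows "kp_average P (kp_mult a x) = kp_mult a (kp_average P x)"
proof -
  interpret P: Vector_Spaces.linear "(*s)" "(*s)" P by fact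
  have left: "kp_mult (\<beta> k) (kp_mult a x) = a $ k *s kp_mult (\<beta> k) x" if "k \<in> {E1, E2, E3, E4}" for k
    using that by (auto simp: vec_eq_iff all_kp_index axis_one_nth)
  \<comment> \<open>The right legs \<open>A11\<close> and \<open>A12\<close> span a right ideal, the
    first row of the matrix block, so \<open>a\<close> on their right only recombines them.\<close>
  have A11: "kp_mult (\<beta> A11) (kp_mult a x) = a $ A11 *s kp_mult (\<beta> A11) x + a $ A12 *s kp_mult (\<beta> A12) x"
    by (simp add: vec_eq_iff all_kp_index axis_one_nth)
  have A12: "kp_mult (\<beta> A12) (kp_mult a x) = a $ A21 *s kp_mult (\<beta> A11) x + a $ A22 *s kp_mult (\<beta> A12) x"
    by (simp add: vec_eq_iff all_kp_index axis_one_nth)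
  show ?thesis
    unfolding kp_average_def A11 A12
    by (simp add: left P.add P.scale) (simp add: vec_eq_iff all_kp_index axis_one_nth algebra_simps)
qed

lemma kp_semisimple_hopf_algebra:
  "semisimple_hopf_algebra kp_mult kp_one kp_comult kp_counit kp_antipode"
proof -
  interpret hopf_algebra kp_mult kp_one kp_comult kp_counit kp_antipode
    by (rule kp_hopf_algebra)
  show ?thesis
  proof
    fix I
    assume I: "left_ideal I"
    then have sub: "vec.subspace I" and ideal: "\<And>a x. x \<in> I \<Longrightarrow> kp_mult a x \<in> I"
      by (auto simp: left_ideal_def)
    \<comment> \<open>A left inverse of the inclusion of \<open>I\<close>, that is, a linear
      projection onto \<open>I\<close>.\<close>
    obtain P where range: "range P \<subseteq> I" and linear: "Vector_Spaces.linear (*s) (*s) P"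
      and fixes_I: "\<And>x. x \<in> I \<Longrightarrow> P x = x"
      using vec.linear_exists_left_inverse_on [OF vec.linear_id sub] by auto
    interpret P: Vector_Spaces.linear "(*s)" "(*s)" P by fact
    define Q where "Q = kp_average P"
    have Q_mult: "Q (kp_mult a x) = kp_mult a (Q x)" for a x
      by (simp add: Q_def kp_average_mult linear)
    have Q_add: "Q (x + y) = Q x + Q y" and Q_scale: "Q (c *s x) = c *s Q x" for x y c
      by (simp_all add: Q_def kp_average_def kp_mult_linear P.add P.scale algebra_simps vec.scale_right_distrib)
    have Q_in: "Q x \<in> I" for x
      unfolding Q_def kp_average_def using range
      by (intro vec.subspace_add sub ideal) auto
    \<comment> \<open>\<open>P\<close> fixes each y_i x because \<open>I\<close> is a left ideal,
      and the products x_i y_i add up to the unit.\<close>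
    have Q_id: "Q x = x" if "x \<in> I" for x
      using that unfolding Q_def kp_average_def
      by (simp add: fixes_I ideal) (simp add: vec_eq_iff all_kp_index axis_one_nth)
    define J where "J = {x. Q x = 0}"
    show "\<exists>J. left_ideal J \<and> I \<inter> J = {0} \<and> {x + y |x y. x \<in> I \<and> y \<in> J} = UNIV"
    proof (intro exI conjI)
      have Q_0: "Q 0 = 0"
        using Q_scale [of 0 0] by simp
      show "left_ideal J"
        by (auto simp: left_ideal_def J_def vec.subspace_def Q_0 Q_add Q_scale Q_mult) (simp add: vec_eq_iff all_kp_index)
      show "I \<inter> J = {0}"
        using Q_id Q_0 vec.subspace_0 [OF sub] by (auto simp: J_def)
      \<comment> \<open>\<open>Q\<close> is idempotent, since it maps into \<open>I\<close> and
        fixes \<open>I\<close>.\<close>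
      have "x - Q x \<in> J" for x
        using Q_add [of "x - Q x" "Q x"] Q_id [OF Q_in] by (simp add: J_def)
      then have "x \<in> {x + y |x y. x \<in> I \<and> y \<in> J}" for x
        using Q_in [of x] by (intro CollectI exI [of _ "Q x"] exI [of _ "x - Q x"]) simp
      then show "{x + y |x y. x \<in> I \<and> y \<in> J} = UNIV"
        by blast
    qed
  qed
qed

section \<open>The solvable series\<close>

context hopf_algebra
begin

lemma mult_tensor_lift:
  "tensor_lift (\<lambda>u v. x \<odot> B u v) t = x \<odot> tensor_lift B t"
proof -
  interpret M: Vector_Spaces.linear "(*s)" "(*s)" "\<lambda>y. x \<odot> y"
    by (rule mult_linear_right)
  show ?thesis
    by (simp add: tensor_lift_def M.sum M.scale)
qed

text \<open>A central \<open>b\<close> can be pulled out in front of the Sweedler sum, leaving the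
  antipode axiom for \<open>a\<close>.\<close>

lemma adjoint_action_central:
  assumes "\<And>x. b \<odot> x = x \<odot> b"
  shows "a \<bullet>\<^sub>a\<^sub>d b = counit a *s b"
proof -
  interpret M: Vector_Spaces.linear "(*s)" "(*s)" "\<lambda>y. b \<odot> y"
    by (rule mult_linear_right)
  have "u \<odot> b \<odot> antipode v = b \<odot> (u \<odot> antipode v)" for u v
    by (metis assms mult_assoc)
  then show ?thesis
    by (simp add: adjoint_action_def mult_tensor_lift antipode_right M.scale mult_one)
qed

lemma tensor_in_tensor_subspace: "v \<in> V \<Longrightarrow> w \<in> W \<Longrightarrow> v \<otimes> w \<in> tensor_subspace V W"
  unfolding tensor_subspace_def by (rule vec.span_base) blast

lemma left_coideal_subalgebra_one: "left_coideal_subalgebra (vec.span {one})"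
proof -
  interpret Delta: Vector_Spaces.linear "(*s)" "(*s)" comult
    by (rule comult_linear)
  interpret M: Vector_Spaces.linear "(*s)" "(*s)" "\<lambda>y. x \<odot> y" for x
    by (rule mult_linear_right)
  have "one \<otimes> one \<in> tensor_subspace UNIV (vec.span {one})"
    by (simp add: tensor_in_tensor_subspace vec.span_base)
  then have "c *s (one \<otimes> one) \<in> tensor_subspace UNIV (vec.span {one})" for c
    unfolding tensor_subspace_def by (rule vec.span_scale)
  then show ?thesis
    using vec.span_base [of one "{one}"] vec.subspace_span [of "{one}"]
    by (auto simp: left_coideal_subalgebra_def unital_subalgebra_def
        vec.span_singleton Delta.scale comult_one M.scale mult_one)
qed

lemma left_coideal_subalgebra_UNIV: "left_coideal_subalgebra UNIV"
proof -
  have "t \<in> tensor_subspace UNIV UNIV" for t :: "complex ^ ('n \<times> 'n)"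
  proof -
    have "t = (\<Sum>p\<in>UNIV. t $ p *s axis p 1)"
      by (simp add: vec_eq_iff axis_one_nth if_distrib cong: if_cong)
    moreover have "axis p 1 = axis (fst p) 1 \<otimes> axis (snd p) 1" for p :: "'n \<times> 'n"
      by (cases p) (auto simp: vec_eq_iff axis_one_nth)
    then have "axis p 1 \<in> tensor_subspace UNIV UNIV" for p :: "'n \<times> 'n"
      by (simp add: tensor_in_tensor_subspace)
    ultimately show ?thesis
      unfolding tensor_subspace_def by (metis (no_types, lifting) vec.span_scale vec.span_sum)
  qed
  then show ?thesis
    by (simp add: left_coideal_subalgebra_def unital_subalgebra_def)
qed

end

definition kp_idem :: "complex ^ kp_index" where
  "kp_idem = \<beta> E1 + \<beta> E2 + \<beta> E3 + \<beta> E4"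

text \<open>The group algebra of the group-like element \<open>kp_idem - (kp_one - kp_idem)\<close>.\<close>

definition kp_group_algebra :: "(complex ^ kp_index) set" where
  "kp_group_algebra = {s *s kp_idem + t *s (kp_one - kp_idem) | s t. True}"

lemma kp_idem_nth [simp]:
  "kp_idem $ E1 = 1" "kp_idem $ E2 = 1" "kp_idem $ E3 = 1" "kp_idem $ E4 = 1"
  "kp_idem $ A11 = 0" "kp_idem $ A12 = 0" "kp_idem $ A21 = 0" "kp_idem $ A22 = 0"
  by (simp_all add: kp_idem_def axis_def)

lemma kp_group_algebra_iff:
  "x \<in> kp_group_algebra \<longleftrightarrow>
     x $ E2 = x $ E1 \<and> x $ E3 = x $ E1 \<and> x $ E4 = x $ E1 \<and>
     x $ A12 = 0 \<and> x $ A21 = 0 \<and> x $ A22 = x $ A11"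
proof
  show "x \<in> kp_group_algebra" if "x $ E2 = x $ E1 \<and> x $ E3 = x $ E1 \<and> x $ E4 = x $ E1 \<and>
     x $ A12 = 0 \<and> x $ A21 = 0 \<and> x $ A22 = x $ A11"
    unfolding kp_group_algebra_def using that
    by (intro CollectI exI [of _ "x $ E1"] exI [of _ "x $ A11"]) (simp add: vec_eq_iff all_kp_index)
qed (auto simp: kp_group_algebra_def)

text \<open>With p = \<open>kp_idem\<close> and q = \<open>kp_one - kp_idem\<close>, the
  comultiplication sends p to p \<otimes> p + q \<otimes> q and q to p \<otimes> q + q \<otimes> p,
  as for functions on the group of order two. Collecting by the left leg leaves right legs in the
  span of p and q, which is the coideal property.\<close>

lemma kp_comult_group_algebra:
  assumes "x \<in> kp_group_algebra"
  shows "kp_comult x =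
    kp_idem \<otimes> x + (kp_one - kp_idem) \<otimes> (x $ A11 *s kp_idem + x $ E1 *s (kp_one - kp_idem))"
proof -
  have "kp_coeff x i j = kp_idem $ i * x $ j +
      (kp_one $ i - kp_idem $ i) * (x $ A11 * kp_idem $ j + x $ E1 * (kp_one $ j - kp_idem $ j))" for i j
    using assms by (cases i; cases j) (simp_all add: kp_group_algebra_iff)
  then show ?thesis
    by (simp add: vec_eq_iff algebra_simps)
qed

theorem theorem3p1:
  shows "semisimple_hopf_algebra kp_mult kp_one kp_comult kp_counit kp_antipode \<and>
         semisimple_hopf_algebra.solvable kp_mult kp_one kp_comult kp_counit kp_antipode"
proof
  show "semisimple_hopf_algebra kp_mult kp_one kp_comult kp_counit kp_antipode"
    by (rule kp_semisimple_hopf_algebra)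
  then interpret semisimple_hopf_algebra kp_mult kp_one kp_comult kp_counit kp_antipode .
  define L where "L j = (if j = 0 then vec.span {kp_one} else if j = 1 then kp_group_algebra else UNIV)"
    for j :: nat
  have one_in: "kp_one \<in> kp_group_algebra" and idem_in: "kp_idem \<in> kp_group_algebra"
    by (simp_all add: kp_group_algebra_iff)
  \<comment> \<open>Such an \<open>x\<close> is a scalar on each of the five summands, hence central
    in the whole algebra.\<close>
  have central: "kp_mult x y = kp_mult y x" if "x \<in> kp_group_algebra" for x y
    using that by (simp add: kp_group_algebra_iff vec_eq_iff all_kp_index)
  have one_nonzero: "kp_one \<noteq> 0" and idem_nonzero: "kp_idem \<noteq> 0"
    by (metis kp_one_nth(1) zero_index zero_neq_one, metis kp_idem_nth(1) zero_index zero_neq_one)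
  have coideal: "left_coideal_subalgebra kp_group_algebra"
    unfolding left_coideal_subalgebra_def unital_subalgebra_def
  proof (intro conjI ballI)
    show "vec.subspace kp_group_algebra"
      by (simp add: vec.subspace_def kp_group_algebra_iff)
    show "kp_one \<in> kp_group_algebra"
      by (fact one_in)
    show "kp_mult x y \<in> kp_group_algebra" if "x \<in> kp_group_algebra" "y \<in> kp_group_algebra" for x y
      using that by (simp add: kp_group_algebra_iff)
    fix x
    assume x: "x \<in> kp_group_algebra"
    have "x $ A11 *s kp_idem + x $ E1 *s (kp_one - kp_idem) \<in> kp_group_algebra"
      by (simp add: kp_group_algebra_iff)
    with x show "kp_comult x \<in> tensor_subspace UNIV kp_group_algebra"
      unfolding kp_comult_group_algebra [OF x] tensor_subspace_def
      by (intro vec.span_add vec.span_base) blast+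
  qed
  have "solvable_series 2 L"
    unfolding solvable_series_def
  proof (intro conjI allI impI)
    show "left_coideal_subalgebra (L j)" for j
      by (simp add: L_def left_coideal_subalgebra_one left_coideal_subalgebra_UNIV coideal)
  next
    fix j :: nat
    assume "j < 2"
    then consider "j = 0" | "j = 1"
      by linarith
    then show "L j \<subset> L (Suc j)"
    proof cases
      case 1
      \<comment> \<open>Scalar multiples of the unit agree at \<open>E1\<close> and
        \<open>A11\<close>, whereas \<open>kp_idem\<close> takes the values 1 and 0 there.\<close>
      have "kp_idem \<notin> vec.span {kp_one}"
        by (auto simp: vec.span_singleton vec_eq_iff all_kp_index)
      moreover have "vec.span {kp_one} \<subseteq> kp_group_algebra"
        by (auto simp: vec.span_singleton kp_group_algebra_iff)
      ultimately show ?thesis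
        using 1 idem_in by (auto simp: L_def)
    next
      case 2
      have "\<beta> E1 \<notin> kp_group_algebra"
        by (simp add: kp_group_algebra_iff axis_one_nth)
      then show ?thesis
        using 2 by (auto simp: L_def)
    qed
  next
    fix j :: nat
    assume "j < 2"
    then consider "j = 0" | "j = 1"
      by linarith
    then show "\<exists>l. integral_of (L j) l \<and> l \<in> center_of (L (Suc j)) \<and>
        (\<forall>a\<in>L (Suc j). \<forall>b\<in>L (Suc j). kp_mult (adjoint_action a b) l = kp_counit a *s kp_mult b l)"
    proof cases
      case 1
      have "integral_of (L 0) kp_one"
        using vec.span_base [of kp_one "{kp_one}"]
        by (auto simp: L_def integral_of_def one_nonzero vec.span_singleton
            kp_counit_def mult_one one_mult)
      moreover have "kp_one \<in> center_of (L 1)"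
        by (simp add: L_def center_of_def one_in mult_one one_mult)
      moreover have "adjoint_action a b = kp_counit a *s b" if "b \<in> L 1" for a b
        using that by (intro adjoint_action_central central) (simp add: L_def)
      ultimately show ?thesis
        using 1 by (intro exI [of _ kp_one]) (simp add: mult_one)
    next
      case 2
      \<comment> \<open>On the one-dimensional summands an element of \<open>L 1\<close> is the
        scalar given by its \<open>E1\<close> coordinate, which is its counit.\<close>
      have "integral_of (L 1) kp_idem"
        by (auto simp: L_def integral_of_def idem_in idem_nonzero kp_group_algebra_iff
            kp_counit_def vec_eq_iff all_kp_index)
      moreover have "kp_idem \<in> center_of (L 2)"
        by (simp add: L_def center_of_def central idem_in)
      \<comment> \<open>Multiplying by \<open>kp_idem\<close> erases the matrix block. At the label
        of a one-dimensional summand only the diagonal coefficient of the coproduct of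
        \<open>a\<close> survives, and by \<open>kp_coeff\<close> all four of these equal
        \<open>a $ E1\<close>, the counit of \<open>a\<close>.\<close>
      moreover have "kp_mult (adjoint_action a b) kp_idem = kp_counit a *s kp_mult b kp_idem" for a b
        by (simp add: vec_eq_iff all_kp_index adjoint_action_def tensor_lift_nth kp_antipode_axis
            sum_kp_index axis_one_nth kp_counit_def)
      ultimately show ?thesis
        using 2 by (intro exI [of _ kp_idem]) (simp add: numeral_2_eq_2)
    qed
  qed
  then show "solvable"
    unfolding solvable_def by (intro exI [of _ 2] exI [of _ L]) (simp add: L_def)
qed

end
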